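(* Let $n\geq 2$ be an integer and let $p\geq 1$ and $q\geq 1$ be (finite) real numbers. (a) If $q\neq 2$, then $\ell_q^n$ does not embed isometrically in $\ell_p$ unless $p=q$. (b) $\ell_2^n$ does not embed isometrically in $\ell_p$ unless $p$ is an even positive integer.
   Context: All vector spaces are over $\mathbb{R}$, and all isometries are linear. $\ell_p$ denotes the space of real sequences $x=(x_j)_{j=1}^\infty$ with $\sum_j|x_j|^p<\infty$ and norm $\|x\|_p=\left(\sum_j|x_j|^p\right)^{1/p}$; $\ell_q^n$ denotes $\mathbb{R}^n$ with the norm $\|x\|_q=\left(\sum_{j=1}^n|x_j|^q\right)^{1/q}$. A normed space $X$ embeds isometrically in $Y$ if there is a linear map $T:X\to Y$ with $\|Tx\|_Y=\|x\|_X$ for all $x\in X$. *)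

theory Defs
  imports "HOL-Analysis.Analysis" "HOL-Library.Function_Algebras"
begin

instantiation "fun" :: (type, real_vector) real_vector
begin

definition scaleR_fun :: "real \<Rightarrow> ('a \<Rightarrow> 'b) \<Rightarrow> 'a \<Rightarrow> 'b" where
  "scaleR_fun c f = (\<lambda>x. c *\<^sub>R f x)"

instance
  by standard (simp_all add: scaleR_fun_def fun_eq_iff scaleR_right_distrib scaleR_left_distrib)

end

(* Absolute values are taken first, so powr is only applied to nonnegative
   bases; 0 powr p = 0 is the intended value at zero entries. *)

definition lp_space :: "real \<Rightarrow> (nat \<Rightarrow> real) set" where
  "lp_space p = {x. summable (\<lambda>j. \<bar>x j\<bar> powr p)}"

definition lp_norm :: "real \<Rightarrow> (nat \<Rightarrow> real) \<Rightarrow> real" where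
  "lp_norm p x = (\<Sum>j. \<bar>x j\<bar> powr p) powr (1 / p)"

definition lq_norm :: "real \<Rightarrow> real ^ 'n \<Rightarrow> real" where
  "lq_norm q x = (\<Sum>j\<in>UNIV. \<bar>x $ j\<bar> powr q) powr (1 / q)"

(* The domain is the whole type 'a with the norm NX; the codomain is the linear
   subspace Y of 'b with the norm NY, which is meaningful on Y only. *)
definition embeds_isometrically ::
  "('a::real_vector \<Rightarrow> real) \<Rightarrow> 'b::real_vector set \<Rightarrow> ('b \<Rightarrow> real) \<Rightarrow> bool" where
  "embeds_isometrically NX Y NY \<longleftrightarrow>
     (\<exists>T :: 'a \<Rightarrow> 'b. linear T \<and> (\<forall>x. T x \<in> Y \<and> NY (T x) = NX x))"

end

theory Submission
  imports Defs
begin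

text \<open>
  Let \<open>a\<close> and \<open>b\<close> be the images of two unit vectors, so that
  \<open>f t = (\<Sum>j. \<bar>a j + t * b j\<bar> powr p) = (1 + \<bar>t\<bar> powr q) powr (p / q)\<close>.
  If \<open>p\<close> is not an even integer, \<open>f\<close> cannot be smooth near a root \<open>t\<^sub>0\<close> of a nonconstant
  \<open>a i + t * b i\<close>: the finite differences of order \<open>M > p\<close> with step \<open>h\<close> near \<open>t\<^sub>0\<close>, divided by
  \<open>h powr p\<close>, tend to 0 by smoothness, while on the series side only the terms vanishing at
  \<open>t\<^sub>0\<close> survive, and these contribute with the same sign. For \<open>q = 2\<close> this is part (b). For
  \<open>p < 2\<close> it shows that \<open>a\<close> and \<open>b\<close> have disjoint supports. For \<open>p \<ge> 2\<close>, the
  second difference of \<open>f\<close> at 0 is of exact order \<open>h powr q\<close>, whereas the series is \<open>O(h\<^sup>2)\<close>,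
  and bounded below by a multiple of \<open>h\<^sup>2\<close> if the supports overlap; so \<open>q \<noteq> 2\<close>
  again forces disjoint supports. Disjoint supports give \<open>2 = f 1 = 2 powr (p / q)\<close>.
\<close>

section \<open>Iterated forward differences\<close>

primrec fdiff :: "nat \<Rightarrow> real \<Rightarrow> (real \<Rightarrow> real) \<Rightarrow> real \<Rightarrow> real" where
  "fdiff 0 h f t = f t"
| "fdiff (Suc n) h f t = fdiff n h f (t + h) - fdiff n h f t"

lemma fdiff_Suc_right: "fdiff (Suc n) h f t = fdiff n h (\<lambda>x. f (x + h) - f x) t"
proof (induction n arbitrary: t)
  case (Suc n)
  show ?case
    by (subst fdiff.simps(2)) (simp only: Suc fdiff.simps(2)[of n h "\<lambda>x. f (x + h) - f x"])
qed simp

lemma fdiff_cmult: "fdiff n h (\<lambda>x. c * f x) t = c * fdiff n h f t"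
  by (induction n arbitrary: t) (simp_all add: right_diff_distrib)

lemma fdiff_affine: "fdiff n h (\<lambda>x. f (x * c + d)) t = fdiff n (h * c) f (t * c + d)"
proof (induction n arbitrary: t)
  case (Suc n)
  have "(t + h) * c + d = t * c + d + h * c" by (simp add: algebra_simps)
  then show ?case by (simp only: Suc fdiff.simps)
qed simp

lemma fdiff_const: "n > 0 \<Longrightarrow> fdiff n h (\<lambda>x. c) t = 0"
proof (induction n arbitrary: t)
  case (Suc n)
  show ?case
    by (cases "n = 0") (simp_all add: Suc.IH)
qed simp

lemma fdiff_uminus_step: "fdiff n (- h) f t = (- 1) ^ n * fdiff n h f (t - real n * h)"
proof (induction n arbitrary: t)
  case (Suc n)
  have "t - h - real n * h + h = t - real n * h" "t - h - real n * h = t - real (Suc n) * h"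
    by (simp_all add: algebra_simps)
  with Suc[of t] Suc[of "t - h"] show ?case by (simp add: algebra_simps)
qed simp

lemma fdiff_cong:
  "(\<And>i. i \<le> n \<Longrightarrow> f (t + real i * h) = g (t + real i * h)) \<Longrightarrow> fdiff n h f t = fdiff n h g t"
proof (induction n arbitrary: t)
  case 0
  then show ?case using "0.prems"[of 0] by simp
next
  case (Suc n)
  have "fdiff n h f (t + h) = fdiff n h g (t + h)"
  proof (rule Suc.IH)
    fix i assume "i \<le> n"
    then show "f (t + h + real i * h) = g (t + h + real i * h)"
      using Suc.prems[of "Suc i"] by (simp add: algebra_simps)
  qed
  moreover have "fdiff n h f t = fdiff n h g t"
    using Suc.prems by (intro Suc.IH) simp
  ultimately show ?case by simp
qed

text \<open>The shifted difference at \<open>t + h\<close> never samples \<open>t\<close>, so each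
  further order only flips the sign with which the value at \<open>t\<close> enters.\<close>

lemma fdiff_eq_except_first:
  "(\<And>i. 1 \<le> i \<Longrightarrow> i \<le> n \<Longrightarrow> f (t + real i * h) = g (t + real i * h))
   \<Longrightarrow> fdiff n h f t - fdiff n h g t = (- 1) ^ n * (f t - g t)"
proof (induction n)
  case (Suc n)
  have "fdiff n h f (t + h) = fdiff n h g (t + h)"
  proof (rule fdiff_cong)
    fix i assume "i \<le> n"
    then show "f (t + h + real i * h) = g (t + h + real i * h)"
      using Suc.prems[of "Suc i"] by (simp add: algebra_simps)
  qed
  moreover have "fdiff n h f t - fdiff n h g t = (- 1) ^ n * (f t - g t)"
    using Suc.prems by (intro Suc.IH) simp
  ultimately show ?case by simp
qed simp

lemma fdiff_sums:
  "(\<And>x. (\<lambda>j. \<phi> j x) sums f x) \<Longrightarrow> (\<lambda>j. fdiff n h (\<phi> j) t) sums fdiff n h f t"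
  by (induction n arbitrary: t) (auto intro: sums_diff)

lemma continuous_on_fdiff:
  "continuous_on UNIV f \<Longrightarrow> continuous_on UNIV (fdiff n h f)"
proof (induction n)
  case (Suc n)
  have "continuous_on UNIV (\<lambda>t. fdiff n h f (t + h))"
    by (rule continuous_on_compose2[OF Suc.IH[OF Suc.prems]]) (auto intro: continuous_intros)
  then show ?case using Suc by (auto intro: continuous_on_diff)
qed simp

text \<open>\<open>F k\<close> plays the k-th derivative of \<open>F 0\<close>. A difference of
  order \<open>Suc n\<close> of \<open>F 0\<close> is one of order \<open>n\<close> of its increment
  over \<open>h\<close>, and the increments of the \<open>F k\<close> again form a chain of
  derivatives; the ordinary mean value theorem then treats the increment of
  \<open>F n\<close>.\<close>

lemma fdiff_mvt:
  assumes "h > 0"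
    and "\<And>k x. k < n \<Longrightarrow> t \<le> x \<Longrightarrow> x \<le> t + real n * h \<Longrightarrow>
           (F k has_real_derivative F (Suc k) x) (at x)"
  shows "\<exists>\<xi>. t \<le> \<xi> \<and> \<xi> \<le> t + real n * h \<and> fdiff n h (F 0) t = h ^ n * F n \<xi>"
  using assms(2)
proof (induction n arbitrary: F)
  case 0
  then show ?case by (intro exI[of _ t]) simp
next
  case (Suc n)
  have nh: "real (Suc n) * h = real n * h + h" by (simp add: algebra_simps)
  define G where "G k x = F k (x + h) - F k x" for k x
  have "\<exists>\<xi>. t \<le> \<xi> \<and> \<xi> \<le> t + real n * h \<and> fdiff n h (G 0) t = h ^ n * G n \<xi>"
  proof (rule Suc.IH)
    fix k x assume kx: "k < n" "t \<le> x" "x \<le> t + real n * h"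
    have "(F k has_real_derivative F (Suc k) (x + h)) (at (x + h))"
      using kx \<open>h > 0\<close> nh by (intro Suc.prems) auto
    then have "((\<lambda>x. F k (x + h)) has_real_derivative F (Suc k) (x + h)) (at x)"
      by (simp add: DERIV_shift)
    moreover have "(F k has_real_derivative F (Suc k) x) (at x)"
      using kx \<open>h > 0\<close> nh by (intro Suc.prems) auto
    ultimately show "(G k has_real_derivative G (Suc k) x) (at x)"
      unfolding G_def by (rule DERIV_diff)
  qed
  then obtain \<xi> where \<xi>: "t \<le> \<xi>" "\<xi> \<le> t + real n * h" "fdiff n h (G 0) t = h ^ n * G n \<xi>"
    by blast
  have "\<exists>z>\<xi>. z < \<xi> + h \<and> F n (\<xi> + h) - F n \<xi> = (\<xi> + h - \<xi>) * F (Suc n) z"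
    using \<xi> \<open>h > 0\<close> nh by (intro MVT2 Suc.prems) auto
  then obtain z where z: "\<xi> < z" "z < \<xi> + h" "G n \<xi> = h * F (Suc n) z"
    by (auto simp: G_def)
  have "fdiff (Suc n) h (F 0) t = fdiff n h (G 0) t"
    by (simp only: fdiff_Suc_right G_def[abs_def])
  then show ?case
    using \<xi> z nh by (intro exI[of _ z]) (auto simp del: fdiff.simps)
qed

section \<open>Differences of \<open>\<bar>x\<bar> powr p\<close>\<close>

text \<open>The product is the falling factorial of \<open>p\<close>; the absolute values make the
  member \<open>k = 0\<close> literally the function that is differenced later.\<close>

lemma falling_powr_deriv:
  fixes p x :: real
  assumes "x > 0"
  shows "((\<lambda>x. (\<Prod>i<k. p - real i) * \<bar>x\<bar> powr (p - real k)) has_real_derivative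
           (\<Prod>i<Suc k. p - real i) * \<bar>x\<bar> powr (p - real (Suc k))) (at x)"
proof -
  have "((\<lambda>x. (\<Prod>i<k. p - real i) * x powr (p - real k)) has_real_derivative
           (\<Prod>i<Suc k. p - real i) * \<bar>x\<bar> powr (p - real (Suc k))) (at x)"
    using assms by (auto intro!: derivative_eq_intros simp: algebra_simps)
  then show ?thesis
    by (rule has_field_derivative_transform_within_open[where S = "{0<..}"]) (use assms in auto)
qed

lemma fdiff_powr_mvt:
  fixes p t :: real
  assumes "t > 0" "h > 0"
  obtains \<xi> where "t \<le> \<xi>" "\<xi> \<le> t + real n * h"
    "fdiff n h (\<lambda>x. \<bar>x\<bar> powr p) t = h ^ n * ((\<Prod>i<n. p - real i) * \<xi> powr (p - real n))"
proof -
  define F where "F k x = (\<Prod>i<k. p - real i) * \<bar>x\<bar> powr (p - real k)" for k x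
  have "\<exists>\<xi>. t \<le> \<xi> \<and> \<xi> \<le> t + real n * h \<and> fdiff n h (F 0) t = h ^ n * F n \<xi>"
    using assms unfolding F_def by (intro fdiff_mvt falling_powr_deriv) auto
  moreover have "F 0 = (\<lambda>x. \<bar>x\<bar> powr p)"
    by (simp add: F_def fun_eq_iff)
  ultimately obtain \<xi> where "t \<le> \<xi>" "\<xi> \<le> t + real n * h"
    "fdiff n h (\<lambda>x. \<bar>x\<bar> powr p) t = h ^ n * F n \<xi>"
    by auto
  then show ?thesis using that[of \<xi>] assms by (simp add: F_def)
qed

text \<open>By evenness the nodes from \<open>- t - real n\<close> to \<open>- t\<close> carry the
  values at \<open>t\<close> to \<open>t + real n\<close> in reverse order, which costs at most a
  sign. This transfers decay from \<open>at_top\<close> to \<open>at_bot\<close>.\<close>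

lemma fdiff_powr_reflect:
  "\<bar>fdiff n 1 (\<lambda>x. \<bar>x\<bar> powr p) (- t - real n)\<bar> = \<bar>fdiff n 1 (\<lambda>x. \<bar>x\<bar> powr p) t\<bar>"
proof -
  have "fdiff n 1 (\<lambda>x. \<bar>x\<bar> powr p) t = fdiff n 1 (\<lambda>x. \<bar>x * (- 1) + 0\<bar> powr p) t"
    by simp
  also have "\<dots> = fdiff n (1 * (- 1)) (\<lambda>x. \<bar>x\<bar> powr p) (t * (- 1) + 0)"
    by (rule fdiff_affine)
  also have "\<dots> = (- 1) ^ n * fdiff n 1 (\<lambda>x. \<bar>x\<bar> powr p) (- t - real n)"
    by (simp add: fdiff_uminus_step)
  finally show ?thesis by (simp add: abs_mult)
qed

text \<open>For \<open>t > 0\<close> the difference is a value of the n-th derivative to the right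
  of \<open>t\<close>, hence at most a constant times \<open>t powr (p - real n)\<close>, whose
  exponent is negative. Reflection covers the other end.\<close>

lemma fdiff_powr_tendsto_0:
  fixes p :: real
  assumes "p < real n"
  shows "(fdiff n 1 (\<lambda>x. \<bar>x\<bar> powr p) \<longlongrightarrow> 0) at_infinity"
proof -
  let ?\<psi> = "fdiff n 1 (\<lambda>x. \<bar>x\<bar> powr p)"
  let ?C = "\<bar>\<Prod>i<n. p - real i\<bar>"
  have lim: "((\<lambda>t. ?C * t powr (p - real n)) \<longlongrightarrow> 0) at_top"
    using tendsto_mult_right_zero[OF tendsto_neg_powr[of "p - real n" "\<lambda>t. t" at_top]] assms
    by (simp add: filterlim_ident)
  have le: "\<bar>?\<psi> t\<bar> \<le> ?C * t powr (p - real n)" if pos: "t > 0" for t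
  proof -
    obtain \<xi> where "t \<le> \<xi>" "?\<psi> t = 1 ^ n * ((\<Prod>i<n. p - real i) * \<xi> powr (p - real n))"
      by (rule fdiff_powr_mvt[OF pos, of 1 n p]) auto
    then show ?thesis using assms pos
      by (auto simp: abs_mult intro!: mult_left_mono powr_mono2')
  qed
  have top: "((\<lambda>t. \<bar>?\<psi> t\<bar>) \<longlongrightarrow> 0) at_top"
    by (rule tendsto_sandwich[OF _ _ tendsto_const lim])
      (auto intro: eventually_mono[OF eventually_gt_at_top[of 0]] le)
  have "filterlim (\<lambda>t::real. - real n + - t) at_top at_bot"
    by (rule filterlim_tendsto_add_at_top[OF tendsto_const filterlim_uminus_at_top_at_bot])
  moreover have "(\<lambda>t::real. - real n + - t) = (\<lambda>t. - t - real n)"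
    by (simp add: fun_eq_iff)
  ultimately have "filterlim (\<lambda>t::real. - t - real n) at_top at_bot"
    by (simp only:)
  then have "((\<lambda>t. \<bar>?\<psi> (- t - real n)\<bar>) \<longlongrightarrow> 0) at_bot"
    by (rule filterlim_compose[OF top])
  then have "((\<lambda>t. \<bar>?\<psi> t\<bar>) \<longlongrightarrow> 0) at_bot"
    by (simp add: fdiff_powr_reflect)
  with top have "((\<lambda>t. \<bar>?\<psi> t\<bar>) \<longlongrightarrow> 0) at_infinity"
    by (simp add: at_infinity_eq_at_top_bot filterlim_sup)
  then show ?thesis by (rule tendsto_rabs_zero_cancel)
qed

text \<open>Decay outside a compact interval, continuity on it. The bound later serves as domination
  for Tannery's theorem.\<close>

lemma fdiff_powr_bounded:
  fixes p :: real
  assumes "p > 0" "p < real n"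
  obtains B where "\<And>t. \<bar>fdiff n 1 (\<lambda>x. \<bar>x\<bar> powr p) t\<bar> \<le> B"
proof -
  let ?\<psi> = "fdiff n 1 (\<lambda>x. \<bar>x\<bar> powr p)"
  have "eventually (\<lambda>t. dist (?\<psi> t) 0 < 1) at_infinity"
    using tendstoD[OF fdiff_powr_tendsto_0[OF assms(2)], of 1] by simp
  then obtain b where b: "\<And>t. b \<le> \<bar>t\<bar> \<Longrightarrow> \<bar>?\<psi> t\<bar> < 1"
    by (auto simp: eventually_at_infinity)
  have "continuous_on UNIV ?\<psi>"
    using assms by (intro continuous_on_fdiff) (auto intro!: continuous_intros continuous_on_powr')
  then have "compact (?\<psi> ` {-b..b})"
    by (intro compact_continuous_image) (auto elim: continuous_on_subset)
  then obtain B where B: "\<And>t. t \<in> {-b..b} \<Longrightarrow> \<bar>?\<psi> t\<bar> \<le> B"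
    using compact_imp_bounded[of "?\<psi> ` {-b..b}"] unfolding bounded_iff by fastforce
  have "\<bar>?\<psi> t\<bar> \<le> max B 1" for t
    using b[of t] B[of t] by (smt (verit) atLeastAtMost_iff)
  then show ?thesis by (rule that)
qed

lemma fdiff_power_eq_0:
  assumes "k < n"
  shows "fdiff n 1 (\<lambda>x. x ^ k) t = 0"
proof -
  \<comment> \<open>For \<open>i > k\<close> the exponent is truncated to 0, but the product then
    contains the factor with \<open>j = k\<close>, so \<open>F i\<close> is still the correct
    derivative.\<close>
  define F where "F i x = (\<Prod>j<i. real k - real j) * x ^ (k - i)" for i and x :: real
  have "(F i has_real_derivative F (Suc i) x) (at x)" for i x
  proof (cases "i \<le> k")
    case True
    then show ?thesis
      unfolding F_def by (auto intro!: derivative_eq_intros simp: of_nat_diff simp del: prod_zero_iff)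
  next
    case False
    then have zero: "(\<Prod>j<i. real k - real j) = 0"
      by (auto intro!: prod_zero)
    show ?thesis unfolding F_def by (simp add: zero)
  qed
  then have "\<exists>\<xi>. t \<le> \<xi> \<and> \<xi> \<le> t + real n * 1 \<and> fdiff n 1 (F 0) t = 1 ^ n * F n \<xi>"
    by (intro fdiff_mvt) auto
  moreover have "(\<Prod>j<n. real k - real j) = 0"
    using assms by (auto intro!: prod_zero)
  moreover have "F 0 = (\<lambda>x. x ^ k)"
    by (simp add: F_def fun_eq_iff)
  ultimately show ?thesis by (auto simp: F_def)
qed

text \<open>For even \<open>p < n\<close> the function is a polynomial of degree below
  \<open>n\<close> and all differences vanish. An odd integer \<open>p\<close> leaves a kink at 0
  that the difference detects; for any other \<open>p\<close> the falling factorial has no zero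
  factor.\<close>

lemma fdiff_powr_nonzero:
  fixes p :: real
  assumes "p > 0" "p < real n" and not_even: "\<not> (\<exists>k::nat. k > 0 \<and> even k \<and> p = real k)"
  obtains y where "fdiff n 1 (\<lambda>x. \<bar>x\<bar> powr p) y \<noteq> 0"
proof (cases "\<exists>k::nat. p = real k")
  case True
  then obtain k where k: "p = real k" by blast
  with assms have "odd k" "k > 0" "k < n" by auto
  \<comment> \<open>Based at \<open>- 1\<close>, only the first sampling point sees the difference between
    \<open>\<bar>x\<bar> powr p\<close> and the polynomial \<open>x ^ k\<close>.\<close>
  have "fdiff n 1 (\<lambda>x. \<bar>x\<bar> powr p) (- 1) - fdiff n 1 (\<lambda>x. x ^ k) (- 1)
        = (- 1) ^ n * (\<bar>- 1\<bar> powr p - (- 1) ^ k)"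
  proof (rule fdiff_eq_except_first)
    \<comment> \<open>The node for \<open>i = 1\<close> is 0, where \<open>0 powr p = 0\<close>
      agrees with \<open>0 ^ k\<close> because \<open>k > 0\<close>.\<close>
    fix i :: nat assume "1 \<le> i"
    with \<open>k > 0\<close> show "\<bar>- 1 + real i * 1\<bar> powr p = (- 1 + real i * 1) ^ k"
      by (cases "i = 1") (auto simp: k powr_realpow)
  qed
  with \<open>odd k\<close> have "fdiff n 1 (\<lambda>x. \<bar>x\<bar> powr p) (- 1) \<noteq> 0"
    by (simp add: fdiff_power_eq_0[OF \<open>k < n\<close>])
  then show ?thesis by (rule that)
next
  case False
  then have "(\<Prod>i<n. p - real i) \<noteq> 0" by auto
  moreover obtain \<xi> where "1 \<le> \<xi>"
    "fdiff n 1 (\<lambda>x. \<bar>x\<bar> powr p) 1 = 1 ^ n * ((\<Prod>i<n. p - real i) * \<xi> powr (p - real n))"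
    by (rule fdiff_powr_mvt[of 1 1 n p]) auto
  ultimately show ?thesis by (intro that[of 1]) auto
qed

lemma fdiff_powr_scale:
  fixes c :: real
  assumes "c \<noteq> 0"
  shows "fdiff n c (\<lambda>x. \<bar>x\<bar> powr p) t = \<bar>c\<bar> powr p * fdiff n 1 (\<lambda>x. \<bar>x\<bar> powr p) (t / c)"
proof -
  have "\<bar>c\<bar> powr p * fdiff n 1 (\<lambda>x. \<bar>x\<bar> powr p) (t / c)
        = fdiff n 1 (\<lambda>x. \<bar>x * c + 0\<bar> powr p) (t / c)"
    unfolding fdiff_cmult[symmetric] by (simp add: abs_mult powr_mult mult.commute)
  also have "\<dots> = fdiff n c (\<lambda>x. \<bar>x\<bar> powr p) t"
    using assms fdiff_affine[of n 1 "\<lambda>x. \<bar>x\<bar> powr p" c 0 "t / c"] by simp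
  finally show ?thesis ..
qed

section \<open>Smoothness of the series excludes roots of nonconstant terms\<close>

text \<open>\<open>F k\<close> is the k-th derivative of the sum near \<open>t\<^sub>0\<close>. The
  rescaled differences of the sum are of order \<open>n powr (p - M)\<close> and vanish in the
  limit, while termwise they converge to a common nonzero factor times nonnegative weights carried
  by the terms with a root at \<open>t\<^sub>0\<close>.\<close>

lemma zero_slope_of_smooth_powr_series:
  fixes a b :: "nat \<Rightarrow> real" and F :: "nat \<Rightarrow> real \<Rightarrow> real"
  assumes p: "p > 0" "p < real M" "\<not> (\<exists>k::nat. k > 0 \<and> even k \<and> p = real k)"
    and sums: "\<And>t. (\<lambda>j. \<bar>a j + t * b j\<bar> powr p) sums F 0 t"
    and sumb: "summable (\<lambda>j. \<bar>b j\<bar> powr p)"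
    and "\<delta> > 0"
    and deriv: "\<And>k x. k < M \<Longrightarrow> \<bar>x - t\<^sub>0\<bar> < \<delta> \<Longrightarrow> (F k has_real_derivative F (Suc k) x) (at x)"
    and bound: "\<And>x. \<bar>x - t\<^sub>0\<bar> < \<delta> \<Longrightarrow> \<bar>F M x\<bar> \<le> C"
    and root: "a i + t\<^sub>0 * b i = 0"
  shows "b i = 0"
proof -
  let ?\<psi> = "fdiff M 1 (\<lambda>x. \<bar>x\<bar> powr p)"
  obtain y where y: "?\<psi> y \<noteq> 0"
    using fdiff_powr_nonzero[OF p] by blast
  obtain B where B: "\<And>t. \<bar>?\<psi> t\<bar> \<le> B"
    using fdiff_powr_bounded[OF p(1,2)] by blast
  \<comment> \<open>\<open>G j n\<close> is the rescaled \<open>M\<close>-th difference, with step \<open>1 / n\<close>, of the \<open>j\<close>-th term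
    at \<open>t\<^sub>0 + y / n\<close>; the offset \<open>y\<close> avoids deciding whether \<open>?\<psi> 0\<close> vanishes.\<close>
  define G where "G j n = \<bar>b j\<bar> powr p * ?\<psi> ((t\<^sub>0 + a j / b j) * real n + y)" for j n
  define w where "w j = (if a j + t\<^sub>0 * b j = 0 then \<bar>b j\<bar> powr p else 0)" for j
  \<comment> \<open>At a root the argument of \<open>?\<psi>\<close> is constantly \<open>y\<close>;
    at other terms it escapes to infinity, where \<open>?\<psi>\<close> decays. If
    \<open>b j = 0\<close>, the factor \<open>\<bar>b j\<bar> powr p = 0\<close> overrides the
    default value of \<open>a j / b j\<close>.\<close>
  have lim: "(\<lambda>n. G j n) \<longlonglongrightarrow> w j * ?\<psi> y" for j
  proof (cases "b j = 0 \<or> a j + t\<^sub>0 * b j = 0")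
    case True
    then have "G j n = w j * ?\<psi> y" for n
      by (cases "b j = 0") (auto simp: G_def w_def field_simps add_eq_0_iff)
    then show ?thesis by simp
  next
    case False
    then have "t\<^sub>0 + a j / b j \<noteq> 0"
      by (auto simp: field_simps)
    then have "filterlim (\<lambda>n. (t\<^sub>0 + a j / b j) * real n + y) at_infinity sequentially"
      by (intro tendsto_add_filterlim_at_infinity' tendsto_mult_filterlim_at_infinity
            tendsto_const tendsto_of_nat) auto
    then have "(\<lambda>n. ?\<psi> ((t\<^sub>0 + a j / b j) * real n + y)) \<longlonglongrightarrow> 0"
      by (rule filterlim_compose[OF fdiff_powr_tendsto_0[OF p(2)]])
    then show ?thesis
      using False by (auto simp: G_def w_def intro: tendsto_mult_right_zero)
  qed
  have "norm (G j n) \<le> \<bar>b j\<bar> powr p * B" for j n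
    unfolding G_def using B by (auto simp: abs_mult intro: mult_left_mono)
  then have dominated: "\<forall>\<^sub>F (j, n) in sequentially \<times>\<^sub>F sequentially. norm (G j n) \<le> \<bar>b j\<bar> powr p * B"
    by (intro always_eventually) auto
  then have tan: "(\<lambda>n. \<Sum>j. G j n) \<longlonglongrightarrow> (\<Sum>j. w j * ?\<psi> y)"
    using tannerys_theorem[OF lim dominated summable_mult2[OF sumb]] by simp
  have G_sum: "(\<Sum>j. G j n) = real n powr p * fdiff M (1 / real n) (F 0) (t\<^sub>0 + y / real n)"
    if "n > 0" for n
  proof -
    have "real n powr p * fdiff M (1 / real n) (\<lambda>t. \<bar>a j + t * b j\<bar> powr p) (t\<^sub>0 + y / real n)
          = G j n" for j
    proof (cases "b j = 0")
      case True
      have "M > 0" using p by (intro gr0I) auto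
      with True show ?thesis by (simp add: G_def fdiff_const)
    next
      case False
      have arg: "((t\<^sub>0 + y / real n) * b j + a j) / (1 / real n * b j) = (t\<^sub>0 + a j / b j) * real n + y"
        using False that by (simp add: field_simps)
      \<comment> \<open>In the variable \<open>t * b j + a j\<close> the step is
        \<open>b j / n\<close>. Homogeneity turns it into step 1, and the power of
        \<open>1 / n\<close> it releases cancels the prefactor.\<close>
      have "fdiff M (1 / real n) (\<lambda>t. \<bar>t * b j + a j\<bar> powr p) (t\<^sub>0 + y / real n)
            = \<bar>1 / real n * b j\<bar> powr p * ?\<psi> ((t\<^sub>0 + a j / b j) * real n + y)"
        unfolding fdiff_affine[where f = "\<lambda>x. \<bar>x\<bar> powr p"]
        using False that by (subst fdiff_powr_scale) (auto simp: arg[symmetric])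
      moreover have "real n powr p * \<bar>1 / real n * b j\<bar> powr p = \<bar>b j\<bar> powr p"
        using that by (simp flip: powr_mult add: abs_mult)
      ultimately show ?thesis
        by (simp add: G_def add.commute[of "a j"] flip: mult.assoc)
    qed
    moreover have "(\<lambda>j. real n powr p * fdiff M (1 / real n) (\<lambda>t. \<bar>a j + t * b j\<bar> powr p) (t\<^sub>0 + y / real n))
        sums (real n powr p * fdiff M (1 / real n) (F 0) (t\<^sub>0 + y / real n))"
      by (intro sums_mult fdiff_sums sums)
    ultimately show ?thesis by (simp add: sums_iff)
  qed
  have "(\<lambda>n. \<Sum>j. G j n) \<longlonglongrightarrow> 0"
  proof (rule Lim_null_comparison)
    have "(\<lambda>n. (\<bar>y\<bar> + real M) / real n) \<longlonglongrightarrow> 0"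
      by (intro tendsto_divide_0[OF tendsto_const] tendsto_of_nat)
    then have "\<forall>\<^sub>F n in sequentially. (\<bar>y\<bar> + real M) / real n < \<delta>"
      using \<open>\<delta> > 0\<close> by (rule order_tendstoD)
    then show "\<forall>\<^sub>F n in sequentially. norm (\<Sum>j. G j n) \<le> C * real n powr (p - real M)"
      using eventually_gt_at_top[of 0]
    proof eventually_elim
      case (elim n)
      \<comment> \<open>The whole interval spanned by the nodes stays within
        \<open>(\<bar>y\<bar> + M) / n\<close> of \<open>t\<^sub>0\<close>.\<close>
      have near: "\<bar>x - t\<^sub>0\<bar> < \<delta>"
        if x: "t\<^sub>0 + y / real n \<le> x" "x \<le> t\<^sub>0 + y / real n + real M * (1 / real n)" for x
      proof -
        have "\<bar>y / real n\<bar> = \<bar>y\<bar> / real n" "real M * (1 / real n) = real M / real n" "real M / real n \<ge> 0"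
          by auto
        with x have "\<bar>x - t\<^sub>0\<bar> \<le> \<bar>y\<bar> / real n + real M / real n" by linarith
        also have "\<dots> = (\<bar>y\<bar> + real M) / real n" by (simp add: add_divide_distrib)
        finally show ?thesis using elim by simp
      qed
      have "\<exists>\<xi>. t\<^sub>0 + y / real n \<le> \<xi> \<and> \<xi> \<le> t\<^sub>0 + y / real n + real M * (1 / real n) \<and>
              fdiff M (1 / real n) (F 0) (t\<^sub>0 + y / real n) = (1 / real n) ^ M * F M \<xi>"
        using elim by (intro fdiff_mvt deriv near) auto
      then obtain \<xi> where \<xi>: "\<bar>F M \<xi>\<bar> \<le> C"
        "fdiff M (1 / real n) (F 0) (t\<^sub>0 + y / real n) = (1 / real n) ^ M * F M \<xi>"
        using bound near by blast
      have "real n powr p * (1 / real n) ^ M = real n powr (p - real M)"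
        using elim by (simp add: powr_diff powr_realpow power_one_over field_simps)
      then have "(\<Sum>j. G j n) = real n powr (p - real M) * F M \<xi>"
        using G_sum[of n] elim \<xi> by (simp flip: mult.assoc)
      then show ?case
        using mult_left_mono[OF \<xi>(1), of "real n powr (p - real M)"] by (simp add: abs_mult mult.commute)
    qed
    show "(\<lambda>n. C * real n powr (p - real M)) \<longlonglongrightarrow> 0"
      using p by (intro tendsto_mult_right_zero tendsto_neg_powr filterlim_real_sequentially) auto
  qed
  then have "(\<Sum>j. w j * ?\<psi> y) = 0"
    using tan LIMSEQ_unique by blast
  moreover have w: "summable w"
    using summable_comparison_test'[OF sumb, of 0 w] by (simp add: w_def)
  ultimately have "(\<Sum>j. w j) = 0"
    using y by (simp flip: suminf_mult2)
  \<comment> \<open>The weights are nonnegative, so a zero sum leaves no room for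
    cancellation.\<close>
  then have "w i = 0"
    using suminf_eq_zero_iff[OF w, unfolded w_def] by (simp add: w_def)
  then show ?thesis
    using root by (simp add: w_def)
qed

section \<open>Derivatives of the Euclidean closed form\<close>

text \<open>Every derivative is a polynomial times a power of \<open>1 + t\<^sup>2\<close>. The
  recursion for \<open>P\<close> is the product rule after factoring out the exponent
  \<open>r - k - 1\<close>; the base never vanishes.\<close>

lemma iterated_derivatives_one_plus_square_powr:
  fixes r :: real
  obtains F :: "nat \<Rightarrow> real \<Rightarrow> real" where "F 0 = (\<lambda>t. (1 + \<bar>t\<bar> powr 2) powr r)"
    "\<And>k t. (F k has_real_derivative F (Suc k) t) (at t)"
proof -
  define P :: "nat \<Rightarrow> real poly" where
    "P = rec_nat 1 (\<lambda>k Q. pderiv Q * [:1, 0, 1:] + smult (2 * (r - real k)) ([:0, 1:] * Q))"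
  define F where "F k t = poly (P k) t * (1 + t\<^sup>2) powr (r - real k)" for k and t :: real
  have pos: "1 + t\<^sup>2 > 0" for t :: real
    by (simp add: add_pos_nonneg)
  have "(F k has_real_derivative F (Suc k) t) (at t)" for k t
  proof -
    have "(F k has_real_derivative
        poly (pderiv (P k)) t * (1 + t\<^sup>2) powr (r - real k) +
        poly (P k) t * ((r - real k) * (1 + t\<^sup>2) powr (r - real k - 1) * (2 * t))) (at t)"
      unfolding F_def using pos[of t]
      by (auto intro!: derivative_eq_intros simp: power2_eq_square algebra_simps)
    moreover have "(1 + t\<^sup>2) powr (r - real k) = (1 + t\<^sup>2) * (1 + t\<^sup>2) powr (r - real k - 1)"
      using pos[of t] by (subst powr_mult_base) auto
    ultimately show ?thesis
      by (simp add: F_def P_def algebra_simps power2_eq_square)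
  qed
  moreover have "F 0 = (\<lambda>t. (1 + \<bar>t\<bar> powr 2) powr r)"
    by (auto simp: F_def P_def fun_eq_iff powr_numeral)
  ultimately show ?thesis using that by blast
qed

section \<open>Inequalities for powers and their second differences\<close>

text \<open>Convexity of the power function on the open half line. The boundary point
  \<open>x = 0\<close> is separate: there the claim reads
  \<open>(1 - r) * y powr r \<le> 0\<close>.\<close>

lemma powr_above_tangent:
  fixes x y r :: real
  assumes "x \<ge> 0" "y > 0" "r \<ge> 1"
  shows "y powr r + r * y powr (r - 1) * (x - y) \<le> x powr r"
proof (cases "x = 0")
  case True
  have "y powr r = y powr (r - 1) * y"
    using assms powr_mult_base[of y "r - 1"] by (simp add: mult.commute)
  moreover have "1 * (y powr (r - 1) * y) \<le> r * (y powr (r - 1) * y)"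
    using assms by (intro mult_right_mono) auto
  ultimately show ?thesis using True assms by simp
next
  case False
  have "convex_on {0<..} (\<lambda>x::real. x powr r)"
  proof (rule f''_ge0_imp_convex)
    show "((\<lambda>x. x powr r) has_real_derivative r * x powr (r - 1)) (at x)"
      and "((\<lambda>x. r * x powr (r - 1)) has_real_derivative r * (r - 1) * x powr (r - 2)) (at x)"
      if "x \<in> {0<..}" for x
      using that by (auto intro!: derivative_eq_intros simp: algebra_simps)
    show "r * (r - 1) * x powr (r - 2) \<ge> 0" if "x \<in> {0<..}" for x
      using assms by simp
  qed auto
  moreover have "((\<lambda>x. x powr r) has_real_derivative r * y powr (r - 1)) (at y within {0<..})"
    by (rule has_field_derivative_at_within[OF has_real_derivative_powr[OF assms(2)]])
  ultimately have "x powr r - y powr r \<ge> r * y powr (r - 1) * (x - y)"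
    using assms False by (intro convex_on_imp_above_tangent[where A = "{0<..}"])
      (auto simp: interior_open connected_Ioi)
  then show ?thesis by simp
qed

text \<open>Write \<open>\<bar>x\<bar> powr p\<close> as the power \<open>p / 2 \<ge> 1\<close> of
  \<open>x\<^sup>2\<close> and use the tangent at \<open>a\<^sup>2\<close> for
  \<open>x = a + v\<close> and \<open>x = a - v\<close>; the cross terms in \<open>a * v\<close>
  cancel.\<close>

lemma powr_second_difference_ge:
  fixes a v p :: real
  assumes "p \<ge> 2" "a \<noteq> 0"
  shows "p * (a\<^sup>2) powr (p / 2 - 1) * v\<^sup>2 \<le> \<bar>a + v\<bar> powr p + \<bar>a - v\<bar> powr p - 2 * \<bar>a\<bar> powr p"
proof -
  have sq: "(x\<^sup>2) powr (p / 2) = \<bar>x\<bar> powr p" for x :: real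
  proof -
    have "x\<^sup>2 = \<bar>x\<bar> powr 2" by (simp add: powr_numeral)
    then show ?thesis by (simp only: powr_powr) simp
  qed
  have tan: "\<bar>a\<bar> powr p + p / 2 * (a\<^sup>2) powr (p / 2 - 1) * (x\<^sup>2 - a\<^sup>2) \<le> \<bar>x\<bar> powr p" for x
    using powr_above_tangent[of "x\<^sup>2" "a\<^sup>2" "p / 2"] assms by (simp add: sq)
  show ?thesis
    using tan[of "a + v"] tan[of "a - v"]
    by (simp add: power2_eq_square algebra_simps) (simp add: field_simps)
qed

text \<open>If \<open>u \<le> v\<close>, both outer terms are at most \<open>(2 * v) powr p\<close>.
  If \<open>u > v > 0\<close>, all nodes are positive and the second-order mean value theorem
  applies with a point below \<open>2 * u\<close>.\<close>

lemma powr_second_difference_le_nonneg: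
  fixes u v p :: real
  assumes "p \<ge> 2" "u \<ge> 0" "v \<ge> 0"
  shows "\<bar>u + v\<bar> powr p + \<bar>u - v\<bar> powr p - 2 * \<bar>u\<bar> powr p
         \<le> p * (p - 1) * 2 powr p * (v\<^sup>2 * u powr (p - 2)) + 2 * 2 powr p * v powr p"
proof -
  consider "v = 0" | "u \<le> v" "v > 0" | "u > v" "v > 0" using assms by linarith
  then show ?thesis
  proof cases
    case 1
    then show ?thesis by simp
  next
    case 2
    have "\<bar>u + v\<bar> powr p \<le> (2 * v) powr p" "\<bar>u - v\<bar> powr p \<le> (2 * v) powr p"
      using 2 assms by (auto intro!: powr_mono2)
    moreover have "(2 * v) powr p = 2 powr p * v powr p"
      using 2 by (simp add: powr_mult)
    moreover have "p * (p - 1) * 2 powr p * (v\<^sup>2 * u powr (p - 2)) \<ge> 0"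
      using assms by simp
    ultimately show ?thesis
      using powr_ge_zero[of "\<bar>u\<bar>" p] by linarith
  next
    case 3
    obtain \<xi> where \<xi>: "u - v \<le> \<xi>" "\<xi> \<le> u - v + real 2 * v"
      "fdiff 2 v (\<lambda>x. \<bar>x\<bar> powr p) (u - v) = v ^ 2 * ((\<Prod>i<2. p - real i) * \<xi> powr (p - real 2))"
      by (rule fdiff_powr_mvt[of "u - v" v 2 p]) (use 3 in auto)
    have "\<xi> powr (p - 2) \<le> (2 * u) powr (p - 2)"
      using \<xi> 3 assms by (intro powr_mono2) auto
    also have "\<dots> \<le> 2 powr p * u powr (p - 2)"
      using 3 by (auto simp: powr_mult intro!: mult_right_mono powr_mono)
    finally have "p * (p - 1) * v\<^sup>2 * \<xi> powr (p - 2) \<le> p * (p - 1) * v\<^sup>2 * (2 powr p * u powr (p - 2))"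
      using assms by (intro mult_left_mono) auto
    then have "v ^ 2 * (p * (p - 1) * \<xi> powr (p - real 2)) \<le> p * (p - 1) * 2 powr p * (v\<^sup>2 * u powr (p - 2))"
      by (simp add: mult_ac)
    moreover have "fdiff 2 v (\<lambda>x. \<bar>x\<bar> powr p) (u - v)
        = \<bar>u + v\<bar> powr p + \<bar>u - v\<bar> powr p - 2 * \<bar>u\<bar> powr p"
      by (simp add: numeral_2_eq_2)
    moreover have "(\<Prod>i<2. p - real i) = p * (p - 1)"
      by (simp add: numeral_2_eq_2)
    ultimately have "\<bar>u + v\<bar> powr p + \<bar>u - v\<bar> powr p - 2 * \<bar>u\<bar> powr p
        \<le> p * (p - 1) * 2 powr p * (v\<^sup>2 * u powr (p - 2))"
      using \<xi>(3) by (simp only:)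
    then show ?thesis by (rule add_increasing2[rotated]) simp
  qed
qed

lemma powr_second_difference_le:
  fixes a b h p :: real
  assumes "p \<ge> 2" "\<bar>h\<bar> \<le> 1"
  shows "\<bar>a + h * b\<bar> powr p + \<bar>a - h * b\<bar> powr p - 2 * \<bar>a\<bar> powr p
         \<le> (p * (p - 1) + 2) * 2 powr p * h\<^sup>2 * (\<bar>a\<bar> powr p + \<bar>b\<bar> powr p)"
proof -
  have split: "x powr p = x\<^sup>2 * x powr (p - 2)" if "x \<ge> 0" for x :: real
    using that by (simp add: powr_diff powr_numeral)
  have "\<bar>a + v\<bar> powr p + \<bar>a - v\<bar> powr p = \<bar>\<bar>a\<bar> + \<bar>v\<bar>\<bar> powr p + \<bar>\<bar>a\<bar> - \<bar>v\<bar>\<bar> powr p" for v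
    by (cases "a \<ge> 0"; cases "v \<ge> 0") (auto simp: abs_minus_commute add.commute)
  then have "\<bar>a + h * b\<bar> powr p + \<bar>a - h * b\<bar> powr p - 2 * \<bar>a\<bar> powr p
      \<le> p * (p - 1) * 2 powr p * (\<bar>h * b\<bar>\<^sup>2 * \<bar>a\<bar> powr (p - 2)) + 2 * 2 powr p * \<bar>h * b\<bar> powr p"
    using powr_second_difference_le_nonneg[of p "\<bar>a\<bar>" "\<bar>h * b\<bar>"] assms by simp
  also have "\<dots> \<le> p * (p - 1) * 2 powr p * (h\<^sup>2 * (\<bar>a\<bar> powr p + \<bar>b\<bar> powr p))
      + 2 * 2 powr p * (h\<^sup>2 * (\<bar>a\<bar> powr p + \<bar>b\<bar> powr p))"
  proof (intro add_mono mult_left_mono)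
    have "b\<^sup>2 * \<bar>a\<bar> powr (p - 2) \<le> \<bar>a\<bar> powr p + \<bar>b\<bar> powr p"
    proof (cases "\<bar>a\<bar> \<le> \<bar>b\<bar>")
      case True
      then have "b\<^sup>2 * \<bar>a\<bar> powr (p - 2) \<le> b\<^sup>2 * \<bar>b\<bar> powr (p - 2)"
        using assms by (intro mult_left_mono powr_mono2) auto
      also have "\<dots> = \<bar>b\<bar> powr p" by (simp add: split)
      finally show ?thesis by (simp add: add_increasing)
    next
      case False
      then have "b\<^sup>2 * \<bar>a\<bar> powr (p - 2) \<le> a\<^sup>2 * \<bar>a\<bar> powr (p - 2)"
        by (intro mult_right_mono) (auto simp: abs_le_square_iff[symmetric])
      also have "\<dots> = \<bar>a\<bar> powr p" by (simp add: split)
      finally show ?thesis by (simp add: add_increasing2)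
    qed
    then show "\<bar>h * b\<bar>\<^sup>2 * \<bar>a\<bar> powr (p - 2) \<le> h\<^sup>2 * (\<bar>a\<bar> powr p + \<bar>b\<bar> powr p)"
      by (simp add: power_mult_distrib mult.assoc mult_left_mono)
    have "\<bar>h\<bar> powr p \<le> h\<^sup>2 * 1"
      unfolding split[OF abs_ge_zero] using assms
      by (auto intro!: mult_left_le powr_le1)
    then show "\<bar>h * b\<bar> powr p \<le> h\<^sup>2 * (\<bar>a\<bar> powr p + \<bar>b\<bar> powr p)"
      by (auto simp: abs_mult powr_mult intro!: mult_mono)
  qed (use assms in auto)
  finally show ?thesis by (simp add: algebra_simps)
qed

text \<open>Mean value theorem with a point in \<open>(1, 2)\<close>; passing from
  \<open>z powr (r - 1)\<close> to \<open>z powr r\<close> avoids a case split at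
  \<open>r = 1\<close>.\<close>

lemma powr_one_plus_le_linear:
  fixes x r :: real
  assumes "0 \<le> x" "x \<le> 1" "r \<ge> 0"
  shows "(1 + x) powr r \<le> 1 + r * 2 powr r * x"
proof (cases "x = 0")
  case False
  have "\<exists>z>1. z < 1 + x \<and> (1 + x) powr r - 1 powr r = (1 + x - 1) * (r * z powr (r - 1))"
    using assms False by (intro MVT2 has_real_derivative_powr) auto
  then obtain z where z: "1 < z" "z < 1 + x" "(1 + x) powr r - 1 = x * (r * z powr (r - 1))"
    by auto
  have "z powr (r - 1) \<le> z powr r" using z by (intro powr_mono) auto
  also have "\<dots> \<le> 2 powr r" using z assms by (intro powr_mono2) auto
  finally have "x * (r * z powr (r - 1)) \<le> x * (r * 2 powr r)"
    using assms by (intro mult_left_mono) auto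
  with z show ?thesis by (simp add: algebra_simps)
qed simp

lemma nonpos_of_le_powr:
  fixes c K s :: real
  assumes "s > 0" "\<And>t. 0 < t \<Longrightarrow> t \<le> 1 \<Longrightarrow> c \<le> K * t powr s"
  shows "c \<le> 0"
proof (rule tendsto_lowerbound)
  have "((\<lambda>t::real. t powr s) \<longlongrightarrow> 0) (at_right 0)"
    using assms(1) by (auto intro!: tendsto_eq_intros eventually_at_right_less simp: eventually_at_filter)
  then show "((\<lambda>t. K * t powr s) \<longlongrightarrow> 0) (at_right 0)"
    by (rule tendsto_mult_right_zero)
  show "\<forall>\<^sub>F t in at_right 0. c \<le> K * t powr s"
    using assms(2) by (auto simp: eventually_at_right_field intro!: exI[of _ 1])
qed simp

section \<open>Consequences of the closed form: comparing \<open>q\<close> with 2 and with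
  \<open>p\<close>\<close>

text \<open>If \<open>q > 2\<close>, the second difference of the closed form at 0 is
  \<open>O(t powr q)\<close>, yet the overlapping term alone contributes at least
  \<open>c * t\<^sup>2\<close> and no other term is negative.\<close>

lemma exponent_le_2_if_overlap:
  fixes a b :: "nat \<Rightarrow> real"
  assumes "p \<ge> 2" "q > 0"
    and sums: "\<And>t. (\<lambda>j. \<bar>a j + t * b j\<bar> powr p) sums (1 + \<bar>t\<bar> powr q) powr (p / q)"
    and overlap: "a i * b i \<noteq> 0"
  shows "q \<le> 2"
proof (rule ccontr)
  assume "\<not> q \<le> 2"
  define D where "D t j = \<bar>a j + t * b j\<bar> powr p + \<bar>a j - t * b j\<bar> powr p - 2 * \<bar>a j\<bar> powr p" for t j
  define c where "c = p * ((a i)\<^sup>2) powr (p / 2 - 1) * (b i)\<^sup>2"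
  \<comment> \<open>The constant of \<open>powr_one_plus_le_linear\<close> for
    \<open>r = p / q\<close>, doubled for the values at \<open>t\<close> and
    \<open>- t\<close>.\<close>
  define K where "K = 2 * (p / q * 2 powr (p / q))"
  have "c \<le> K * t powr (q - 2)" if t: "0 < t" "t \<le> 1" for t
  proof -
    have D_sums: "D t sums ((1 + \<bar>t\<bar> powr q) powr (p / q) + (1 + \<bar>t\<bar> powr q) powr (p / q) - 2 * 1)"
      unfolding D_def using sums[of t] sums[of "- t"] sums[of 0] assms
      by (intro sums_diff sums_add sums_mult) auto
    have "D t j \<ge> 0" for j
    proof (cases "a j = 0")
      case False
      have "0 \<le> p * ((a j)\<^sup>2) powr (p / 2 - 1) * (t * b j)\<^sup>2" using assms by simp
      also have "\<dots> \<le> D t j" unfolding D_def using assms False by (intro powr_second_difference_ge)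
      finally show ?thesis .
    qed (simp add: D_def)
    then have "D t i \<le> suminf (D t)"
      using sum_le_suminf[of "D t" "{i}"] D_sums by (auto simp: sums_iff)
    moreover have "c * t\<^sup>2 \<le> D t i"
      using powr_second_difference_ge[of p "a i" "t * b i"] assms
      by (simp add: D_def c_def power_mult_distrib mult_ac)
    moreover have "(1 + t powr q) powr (p / q) \<le> 1 + p / q * 2 powr (p / q) * t powr q"
      using t assms by (intro powr_one_plus_le_linear) (auto intro!: powr_le1)
    moreover have "t powr q = t powr (q - 2) * t\<^sup>2"
      using t by (simp add: powr_diff powr_numeral)
    ultimately have "c * t\<^sup>2 \<le> K * t powr (q - 2) * t\<^sup>2"
      using D_sums t by (simp add: sums_iff K_def)
    then show ?thesis by (rule mult_right_le_imp_le) (use t in simp)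
  qed
  then have "c \<le> 0" using \<open>\<not> q \<le> 2\<close> by (intro nonpos_of_le_powr[of "q - 2"]) auto
  moreover have "c > 0" using assms by (simp add: c_def)
  ultimately show False by simp
qed

text \<open>Summing the termwise upper bounds makes the second difference at 0 at most
  \<open>2 * K * t\<^sup>2\<close>, whereas for \<open>q < 2\<close> the closed form makes it at
  least \<open>2 * (p / q) * t powr q\<close>.\<close>

lemma exponent_ge_2:
  fixes a b :: "nat \<Rightarrow> real"
  assumes "p \<ge> 2" "q > 0"
    and sums: "\<And>t. (\<lambda>j. \<bar>a j + t * b j\<bar> powr p) sums (1 + \<bar>t\<bar> powr q) powr (p / q)"
    and sumb: "(\<lambda>j. \<bar>b j\<bar> powr p) sums 1"
  shows "q \<ge> 2"
proof (rule ccontr)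
  assume "\<not> q \<ge> 2"
  define K where "K = (p * (p - 1) + 2) * 2 powr p"
  have "p / q \<le> K * t powr (2 - q)" if t: "0 < t" "t \<le> 1" for t
  proof -
    have suma: "(\<lambda>j. \<bar>a j\<bar> powr p) sums 1"
      using sums[of 0] assms by simp
    define D where "D j = \<bar>a j + t * b j\<bar> powr p + \<bar>a j - t * b j\<bar> powr p - 2 * \<bar>a j\<bar> powr p" for j
    have "D j \<le> K * t\<^sup>2 * (\<bar>a j\<bar> powr p + \<bar>b j\<bar> powr p)" for j
      unfolding D_def K_def using t assms(1) by (intro powr_second_difference_le) auto
    moreover have "D sums
        ((1 + \<bar>t\<bar> powr q) powr (p / q) + (1 + \<bar>t\<bar> powr q) powr (p / q) - 2 * 1)"
      unfolding D_def using sums[of t] sums[of "- t"] suma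
      by (intro sums_diff sums_add sums_mult) auto
    moreover have "(\<lambda>j. K * t\<^sup>2 * (\<bar>a j\<bar> powr p + \<bar>b j\<bar> powr p)) sums (K * t\<^sup>2 * (1 + 1))"
      by (intro sums_mult sums_add suma sumb)
    ultimately have "(1 + \<bar>t\<bar> powr q) powr (p / q) + (1 + \<bar>t\<bar> powr q) powr (p / q) - 2 * 1 \<le> K * t\<^sup>2 * (1 + 1)"
      by (rule sums_le)
    \<comment> \<open>Bernoulli's inequality, available because \<open>q < 2 \<le> p\<close> gives
      \<open>p / q \<ge> 1\<close>.\<close>
    moreover have "1 + p / q * t powr q \<le> (1 + t powr q) powr (p / q)"
      using powr_above_tangent[of "1 + t powr q" 1 "p / q"] assms \<open>\<not> q \<ge> 2\<close> by simp
    moreover have "t\<^sup>2 = t powr (2 - q) * t powr q"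
      using t by (simp add: powr_numeral flip: powr_add)
    ultimately have "p / q * t powr q \<le> K * t powr (2 - q) * t powr q"
      using t by simp
    then show ?thesis by (rule mult_right_le_imp_le) (use t in simp)
  qed
  then have "p / q \<le> 0" using \<open>\<not> q \<ge> 2\<close> by (intro nonpos_of_le_powr[of "2 - q"]) auto
  then show False using assms by (simp add: divide_le_0_iff)
qed

lemma exponents_eq_of_disjoint:
  fixes a b :: "nat \<Rightarrow> real"
  assumes "p > 0" "q > 0"
    and sums: "\<And>t. (\<lambda>j. \<bar>a j + t * b j\<bar> powr p) sums (1 + \<bar>t\<bar> powr q) powr (p / q)"
    and sumb: "(\<lambda>j. \<bar>b j\<bar> powr p) sums 1"
    and disjoint: "\<And>j. a j * b j = 0"
  shows "p = q"
proof -
  have "\<bar>a j + 1 * b j\<bar> powr p = \<bar>a j\<bar> powr p + \<bar>b j\<bar> powr p" for j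
    using disjoint[of j] by auto
  moreover have "(\<lambda>j. \<bar>a j\<bar> powr p + \<bar>b j\<bar> powr p) sums (1 + 1)"
    using sums[of 0] assms by (intro sums_add sumb) auto
  ultimately have "2 powr (p / q) = 2 powr 1"
    using sums[of 1] sums_unique2 by auto
  then have "p / q = 1" by (subst (asm) powr_inj) auto
  with assms show ?thesis by simp
qed

section \<open>Applying the smoothness criterion\<close>

text \<open>The closed form is smooth at every \<open>t > 0\<close>, so the criterion rules out a
  positive root. As \<open>p < 2\<close>, order \<open>M = 2\<close> suffices and two explicit
  derivatives are enough.\<close>

lemma root_nonpos_if_p_lt_2:
  fixes a b :: "nat \<Rightarrow> real"
  assumes "p > 0" "p < 2" "q > 0"
    and sums: "\<And>t. (\<lambda>j. \<bar>a j + t * b j\<bar> powr p) sums (1 + \<bar>t\<bar> powr q) powr (p / q)"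
    and sumb: "(\<lambda>j. \<bar>b j\<bar> powr p) sums 1"
    and root: "a i + t\<^sub>0 * b i = 0" "b i \<noteq> 0"
  shows "t\<^sub>0 \<le> 0"
proof (rule ccontr)
  assume "\<not> t\<^sub>0 \<le> 0"
  define r where "r = p / q"
  define F1 where "F1 t = r * (1 + t powr q) powr (r - 1) * (q * t powr (q - 1))" for t
  define F2 where "F2 t = r * (1 + t powr q) powr (r - 1) * (q * ((q - 1) * t powr (q - 2)))
    + r * ((r - 1) * (1 + t powr q) powr (r - 2) * (q * t powr (q - 1))) * (q * t powr (q - 1))" for t
  define F where "F k = (if k = 0 then \<lambda>t. (1 + \<bar>t\<bar> powr q) powr r else if k = 1 then F1 else F2)" for k :: nat
  have pos: "0 < 1 + t powr q" for t by (simp add: add_pos_nonneg)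
  have d0: "(F 0 has_real_derivative F1 t) (at t)" if "t > 0" for t
  proof (rule has_field_derivative_transform_within_open[where S = "{0<..}"])
    show "((\<lambda>t. (1 + t powr q) powr r) has_real_derivative F1 t) (at t)"
      unfolding F1_def using that pos[of t] by (auto intro!: derivative_eq_intros)
  qed (use that in \<open>auto simp: F_def\<close>)
  have d1: "(F1 has_real_derivative F2 t) (at t)" if "t > 0" for t
    unfolding F1_def F2_def using that pos[of t]
    by (auto intro!: derivative_eq_intros simp: algebra_simps)
  \<comment> \<open>Radius \<open>t\<^sub>0 / 2\<close> keeps the ball away from 0, where
    \<open>t powr q\<close> may fail to be smooth.\<close>
  have nonzero: "t \<noteq> 0" if "t \<in> cball t\<^sub>0 (t\<^sub>0 / 2)" for t
  proof -
    have "\<bar>t\<^sub>0 - t\<bar> \<le> t\<^sub>0 / 2" using that by (simp add: dist_real_def)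
    then show ?thesis using \<open>\<not> t\<^sub>0 \<le> 0\<close> by linarith
  qed
  have cont: "continuous_on (cball t\<^sub>0 (t\<^sub>0 / 2)) (\<lambda>t. t powr s)" for s
    using nonzero by (intro continuous_on_powr continuous_on_id continuous_on_const) blast
  have cont': "continuous_on (cball t\<^sub>0 (t\<^sub>0 / 2)) (\<lambda>t. (1 + t powr q) powr s)" for s
    using pos by (intro continuous_on_powr continuous_on_add cont continuous_on_const)
      (metis less_irrefl)
  have "continuous_on (cball t\<^sub>0 (t\<^sub>0 / 2)) F2"
    unfolding F2_def
    by (intro continuous_on_add continuous_on_mult continuous_on_const cont cont')
  then have "compact (F2 ` cball t\<^sub>0 (t\<^sub>0 / 2))"
    by (intro compact_continuous_image) auto
  then obtain C where C: "\<And>t. t \<in> cball t\<^sub>0 (t\<^sub>0 / 2) \<Longrightarrow> \<bar>F2 t\<bar> \<le> C"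
    using compact_imp_bounded[of "F2 ` cball t\<^sub>0 (t\<^sub>0 / 2)"] unfolding bounded_iff by fastforce
  have "b i = 0"
  proof (rule zero_slope_of_smooth_powr_series[where M = 2 and F = F and C = C and \<delta> = "t\<^sub>0 / 2"
        and p = p and a = a and i = i and t\<^sub>0 = t\<^sub>0])
    show "\<not> (\<exists>k::nat. k > 0 \<and> even k \<and> p = real k)"
      using assms(2) by (auto elim!: evenE)
    show "(\<lambda>j. \<bar>a j + t * b j\<bar> powr p) sums F 0 t" for t
      using sums by (simp add: F_def r_def)
    show "(F k has_real_derivative F (Suc k) t) (at t)" if "k < 2" "\<bar>t - t\<^sub>0\<bar> < t\<^sub>0 / 2" for k t
    proof -
      have "t > 0" using that \<open>\<not> t\<^sub>0 \<le> 0\<close> by linarith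
      moreover have "k = 0 \<or> k = 1" using that by linarith
      ultimately show ?thesis using d0[of t] d1[of t] by (auto simp: F_def)
    qed
    show "\<bar>F 2 t\<bar> \<le> C" if "\<bar>t - t\<^sub>0\<bar> < t\<^sub>0 / 2" for t
      using C[of t] that by (simp add: F_def dist_real_def abs_minus_commute)
    show "summable (\<lambda>j. \<bar>b j\<bar> powr p)" using sumb by (rule sums_summable)
  qed (use assms \<open>\<not> t\<^sub>0 \<le> 0\<close> in auto)
  with root show False by simp
qed

text \<open>The closed form is even in \<open>t\<close>, so \<open>b\<close> may be replaced by
  \<open>- b\<close>; the root \<open>- a i / b i\<close> and its negative are then both
  nonpositive.\<close>

lemma disjoint_if_p_lt_2:
  fixes a b :: "nat \<Rightarrow> real"
  assumes "p > 0" "p < 2" "q > 0"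
    and sums: "\<And>t. (\<lambda>j. \<bar>a j + t * b j\<bar> powr p) sums (1 + \<bar>t\<bar> powr q) powr (p / q)"
    and sumb: "(\<lambda>j. \<bar>b j\<bar> powr p) sums 1"
  shows "a i * b i = 0"
proof (cases "b i = 0")
  case False
  have "- a i / b i \<le> 0"
    using False assms by (intro root_nonpos_if_p_lt_2[of p q a b i]) auto
  moreover have "a i / b i \<le> 0"
  proof (rule root_nonpos_if_p_lt_2[of p q a "\<lambda>j. - b j" i])
    show "(\<lambda>j. \<bar>a j + t * - b j\<bar> powr p) sums (1 + \<bar>t\<bar> powr q) powr (p / q)" for t
      using sums[of "- t"] by simp
  qed (use False assms in auto)
  ultimately show ?thesis using False by (simp add: divide_le_0_iff)
qed simp

text \<open>For \<open>q = 2\<close> the closed form is smooth everywhere, so the criterion applies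
  at the root of any term with nonzero slope; such a term exists because \<open>b\<close> has norm
  1.\<close>

lemma even_exponent_if_euclidean:
  fixes a b :: "nat \<Rightarrow> real"
  assumes "p > 0"
    and sums: "\<And>t. (\<lambda>j. \<bar>a j + t * b j\<bar> powr p) sums (1 + \<bar>t\<bar> powr 2) powr (p / 2)"
    and sumb: "(\<lambda>j. \<bar>b j\<bar> powr p) sums 1"
  shows "\<exists>k::nat. k > 0 \<and> even k \<and> p = real k"
proof (rule ccontr)
  assume not_even: "\<not> (\<exists>k::nat. k > 0 \<and> even k \<and> p = real k)"
  obtain i where i: "b i \<noteq> 0"
    using sumb sums_unique2[OF sums_zero] by fastforce
  define t\<^sub>0 where "t\<^sub>0 = - a i / b i"
  obtain M where M: "p < real M" using reals_Archimedean2 by blast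
  obtain F where F: "F 0 = (\<lambda>t. (1 + \<bar>t\<bar> powr 2) powr (p / 2))"
    "\<And>k t. (F k has_real_derivative F (Suc k) t) (at t)"
    using iterated_derivatives_one_plus_square_powr by blast
  have "continuous_on (cball t\<^sub>0 1) (F M)"
    using F(2) by (intro continuous_at_imp_continuous_on ballI DERIV_isCont)
  then have "compact (F M ` cball t\<^sub>0 1)"
    by (intro compact_continuous_image) auto
  then obtain C where C: "\<And>t. t \<in> cball t\<^sub>0 1 \<Longrightarrow> \<bar>F M t\<bar> \<le> C"
    using compact_imp_bounded[of "F M ` cball t\<^sub>0 1"] unfolding bounded_iff by fastforce
  have "b i = 0"
  proof (rule zero_slope_of_smooth_powr_series[where M = M and F = F and C = C and \<delta> = 1
        and p = p and a = a and i = i and t\<^sub>0 = t\<^sub>0])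
    show "\<bar>F M t\<bar> \<le> C" if "\<bar>t - t\<^sub>0\<bar> < 1" for t
      using C[of t] that by (simp add: dist_real_def abs_minus_commute)
  qed (use assms F M not_even i sums_summable[OF sumb] in \<open>auto simp: t\<^sub>0_def\<close>)
  with i show False by simp
qed

section \<open>From an embedding to the series, and the conclusion\<close>

lemma embedding_powr_series:
  fixes p q :: real
  assumes "CARD('n::finite) \<ge> 2" "p > 0" "q > 0"
    and "embeds_isometrically (lq_norm q :: real ^ 'n \<Rightarrow> real) (lp_space p) (lp_norm p)"
  obtains a b where "\<And>t. (\<lambda>j. \<bar>a j + t * b j\<bar> powr p) sums (1 + \<bar>t\<bar> powr q) powr (p / q)"
    "(\<lambda>j. \<bar>b j\<bar> powr p) sums 1"
proof -
  obtain T :: "real ^ 'n \<Rightarrow> nat \<Rightarrow> real" where T: "linear T"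
    "\<And>x. T x \<in> lp_space p" "\<And>x. lp_norm p (T x) = lq_norm q x"
    using assms(4) unfolding embeds_isometrically_def by blast
  obtain m n :: 'n where "m \<noteq> n"
    using assms(1) by (metis UNIV_I card_le_Suc0_iff_eq finite not_less_eq_eq numeral_2_eq_2)
  have norm_sums: "(\<lambda>j. \<bar>T x j\<bar> powr p) sums (\<Sum>j\<in>UNIV. \<bar>x $ j\<bar> powr q) powr (p / q)" for x
  proof -
    let ?S = "\<Sum>j. \<bar>T x j\<bar> powr p"
    have summ: "summable (\<lambda>j. \<bar>T x j\<bar> powr p)"
      using T(2)[of x] by (simp add: lp_space_def)
    have "?S powr (1 / p) = (\<Sum>j\<in>UNIV. \<bar>x $ j\<bar> powr q) powr (1 / q)"
      using T(3)[of x] by (simp add: lp_norm_def lq_norm_def)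
    then have "(?S powr (1 / p)) powr p = ((\<Sum>j\<in>UNIV. \<bar>x $ j\<bar> powr q) powr (1 / q)) powr p"
      by simp
    moreover have "?S \<ge> 0" using summ by (intro suminf_nonneg) auto
    ultimately have "?S = (\<Sum>j\<in>UNIV. \<bar>x $ j\<bar> powr q) powr (p / q)"
      using assms by (simp add: powr_powr)
    with summ show ?thesis by (simp add: sums_iff)
  qed
  define a where "a = T (axis m 1)"
  define b where "b = T (axis n 1)"
  have "(\<lambda>j. \<bar>a j + t * b j\<bar> powr p) sums (1 + \<bar>t\<bar> powr q) powr (p / q)" for t
  proof -
    let ?x = "axis m 1 + t *\<^sub>R axis n 1 :: real ^ 'n"
    have "T ?x j = a j + t * b j" for j
      using T(1) by (simp add: a_def b_def linear_add linear_scale scaleR_fun_def)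
    \<comment> \<open>Coordinates other than \<open>m\<close> and \<open>n\<close> contribute
      \<open>0 powr q = 0\<close>.\<close>
    moreover have "\<bar>?x $ j\<bar> powr q = (if j = m then 1 else 0) + (if j = n then \<bar>t\<bar> powr q else 0)" for j
      using \<open>m \<noteq> n\<close> by (auto simp: axis_def)
    ultimately show ?thesis
      using norm_sums[of ?x] by (simp add: sum.distrib)
  qed
  moreover have "\<bar>axis n 1 $ j\<bar> powr q = (if j = n then 1 else 0)" for j :: 'n
    by (auto simp: axis_def)
  then have "(\<lambda>j. \<bar>b j\<bar> powr p) sums 1"
    using norm_sums[of "axis n 1"] by (simp add: b_def)
  ultimately show ?thesis by (rule that)
qed

theorem theorem4:
  fixes p q :: real
  assumes "CARD('n::finite) \<ge> 2" and "p \<ge> 1" and "q \<ge> 1"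
  shows "(q \<noteq> 2 \<and> p \<noteq> q \<longrightarrow>
            \<not> embeds_isometrically (lq_norm q :: real ^ 'n \<Rightarrow> real) (lp_space p) (lp_norm p)) \<and>
         (\<not> (\<exists>k::nat. k > 0 \<and> even k \<and> p = real k) \<longrightarrow>
            \<not> embeds_isometrically (lq_norm 2 :: real ^ 'n \<Rightarrow> real) (lp_space p) (lp_norm p))"
proof (intro conjI impI notI)
  assume ne: "q \<noteq> 2 \<and> p \<noteq> q"
    and "embeds_isometrically (lq_norm q :: real ^ 'n \<Rightarrow> real) (lp_space p) (lp_norm p)"
  with assms obtain a b
    where sums: "\<And>t. (\<lambda>j. \<bar>a j + t * b j\<bar> powr p) sums (1 + \<bar>t\<bar> powr q) powr (p / q)"
      and sumb: "(\<lambda>j. \<bar>b j\<bar> powr p) sums 1"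
    using embedding_powr_series[of p q] by auto
  have "a j * b j = 0" for j
  proof (cases "p < 2")
    case True
    then show ?thesis using assms by (intro disjoint_if_p_lt_2[OF _ _ _ sums sumb]) auto
  next
    case False
    \<comment> \<open>An overlap would also give \<open>q \<le> 2\<close>, hence the excluded value
      \<open>q = 2\<close>.\<close>
    then have "q \<ge> 2" using assms by (intro exponent_ge_2[OF _ _ sums sumb]) auto
    then show ?thesis
      using False ne assms exponent_le_2_if_overlap[OF _ _ sums, of j] by fastforce
  qed
  then have "p = q" using assms by (intro exponents_eq_of_disjoint[OF _ _ sums sumb]) auto
  with ne show False by simp
next
  assume "\<not> (\<exists>k::nat. k > 0 \<and> even k \<and> p = real k)"
    and "embeds_isometrically (lq_norm 2 :: real ^ 'n \<Rightarrow> real) (lp_space p) (lp_norm p)"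
  moreover from this(2) assms obtain a b
    where "\<And>t. (\<lambda>j. \<bar>a j + t * b j\<bar> powr p) sums (1 + \<bar>t\<bar> powr 2) powr (p / 2)"
      and "(\<lambda>j. \<bar>b j\<bar> powr p) sums 1"
    using embedding_powr_series[of p 2] by auto
  ultimately show False
    using even_exponent_if_euclidean[of p a b] assms by auto
qed

end
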